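(* Let $V\subseteq L^p(\mathbb{R}^n)$ be the range of an idempotent integral operator $T$ with kernel $K$ satisfying the standing assumptions listed in the context. Let $R>0$, $\delta<1$, $C_R=[-\frac R2,\frac R2]^n$ and $$V(R,\delta)=\Big\{ f\in V : (1-\delta)\leq \int_{C_R} |f(x)|^p\, dx \ \text{ and }\ \|f\|_{L^p(\mathbb{R}^n)}=1 \Big\}.$$ Then $V(R,\delta)$ is totally bounded with respect to $\|\cdot\|_{L^\infty(C_R)}$.
   Context: Functions are real-valued. Let $n\ge 1$, $1\le p<\infty$, $\frac1p+\frac1{p'}=1$ (with $p'=\infty$ if $p=1$), and $\|x\|_1=\sum_{i=1}^n|x(i)|$ for $x=(x(1),\dots,x(n))\in\mathbb{R}^n$. Standing assumptions: $T:L^p(\mathbb{R}^n)\to L^p(\mathbb{R}^n)$, $Tf(x)=\int_{\mathbb{R}^n}K(x,y)f(y)\,dy$, is an integral operator with $T^2=T$, whose (measurable) kernel $K$ is symmetric, $K(x,y)=K(y,x)$, and satisfies: (1) regularity: $\lim_{\varepsilon\to 0}\big\|\sup_{z\in\mathbb{R}^n}|osc_\varepsilon(K)(\cdot+z,z)|\big\|_{L^1(\mathbb{R}^n)}=0$, where $osc_\varepsilon(K)(x,y)=\sup_{x',y'\in[-\varepsilon,\varepsilon]^n}|K(x+x',y+y')-K(x,y)|$; (2) decay: $|K(x,y)|\le \dfrac{C}{(1+\|x-y\|_1)^\alpha}$ for all $x,y\in\mathbb{R}^n$, with constants $C>0$ and $\alpha>\frac{n}{p'}+n+1$ (where $n/p'=0$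 if $p'=\infty$). $V$ denotes the range of $T$; it is a closed reproducing kernel subspace of $L^p(\mathbb{R}^n)$. Each $f\in V$ is identified with its pointwise-defined representative $f(x)=\int_{\mathbb{R}^n}K(x,y)f(y)\,dy$, $x\in\mathbb{R}^n$. *)

theory Defs
  imports "HOL-Analysis.Analysis" "HOL-Probability.Essential_Supremum"
begin

text \<open>
  Elements of \<open>L\<^sup>p\<close> are represented by functions rather than by almost-everywhere classes;
  equality of classes is therefore written with \<open>AE\<close>. Only finite exponents \<open>p \<ge> 1\<close> are used.
\<close>

definition Lp_space :: "real \<Rightarrow> 'a measure \<Rightarrow> ('a \<Rightarrow> real) set" where
  "Lp_space p M = {f \<in> borel_measurable M. integrable M (\<lambda>x. \<bar>f x\<bar> powr p)}"

definition Lp_norm :: "real \<Rightarrow> 'a measure \<Rightarrow> ('a \<Rightarrow> real) \<Rightarrow> real" where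
  "Lp_norm p M f = (\<integral>x. \<bar>f x\<bar> powr p \<partial>M) powr (1 / p)"

definition Linf_norm :: "'a measure \<Rightarrow> ('a \<Rightarrow> real) \<Rightarrow> ereal" where
  "Linf_norm M f = esssup M (\<lambda>x. ereal \<bar>f x\<bar>)"

text \<open>
  \<open>1/p'\<close> for the conjugate exponent \<open>p'\<close> of \<open>p\<close>; the value \<open>0\<close> at \<open>p = 1\<close> encodes
  \<open>p' = \<infinity>\<close>.
\<close>

definition inverse_conjugate :: "real \<Rightarrow> real" where
  "inverse_conjugate p = 1 - 1 / p"

definition norm1 :: "real ^ 'n \<Rightarrow> real" where
  "norm1 x = (\<Sum>i\<in>UNIV. \<bar>x $ i\<bar>)"

text \<open>The cube \<open>[-r, r]\<^sup>n\<close>.\<close>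

definition cube :: "real \<Rightarrow> (real ^ 'n) set" where
  "cube r = cbox (\<chi> i. - r) (\<chi> i. r)"

definition int_op ::
  "(real ^ 'n \<Rightarrow> real ^ 'n \<Rightarrow> real) \<Rightarrow> (real ^ 'n \<Rightarrow> real) \<Rightarrow> real ^ 'n \<Rightarrow> real" where
  "int_op K f x = (\<integral>y. K x y * f y \<partial>lebesgue)"

definition osc ::
  "real \<Rightarrow> (real ^ 'n \<Rightarrow> real ^ 'n \<Rightarrow> real) \<Rightarrow> real ^ 'n \<Rightarrow> real ^ 'n \<Rightarrow> ennreal" where
  "osc \<epsilon> K x y = (SUP x'\<in>cube \<epsilon>. SUP y'\<in>cube \<epsilon>. ennreal \<bar>K (x + x') (y + y') - K x y\<bar>)"

definition osc_envelope :: "real \<Rightarrow> (real ^ 'n \<Rightarrow> real ^ 'n \<Rightarrow> real) \<Rightarrow> real ^ 'n \<Rightarrow> ennreal" where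
  "osc_envelope \<epsilon> K x = (SUP z. osc \<epsilon> K (x + z) z)"

text \<open>
  Speaking of the \<open>L\<^sup>1\<close> norm of the envelope presupposes that it is measurable. This has to be
  required explicitly: it is a supremum over uncountably many points, and the integral of a
  non-measurable function is only a lower integral.
\<close>

definition regular_kernel :: "(real ^ 'n \<Rightarrow> real ^ 'n \<Rightarrow> real) \<Rightarrow> bool" where
  "regular_kernel K \<longleftrightarrow>
     (\<forall>\<^sub>F \<epsilon> in at_right 0. osc_envelope \<epsilon> K \<in> borel_measurable lebesgue) \<and>
     ((\<lambda>\<epsilon>. \<integral>\<^sup>+ x. osc_envelope \<epsilon> K x \<partial>lebesgue) \<longlongrightarrow> 0) (at_right 0)"

text \<open>
  The range of the integral operator, each class being represented by the function
  \<open>x \<mapsto> \<integral> K x y * f y dy\<close>, defined at every point; hence the last condition holds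
  everywhere and not only almost everywhere.
\<close>

definition op_range :: "real \<Rightarrow> (real ^ 'n \<Rightarrow> real ^ 'n \<Rightarrow> real) \<Rightarrow> (real ^ 'n \<Rightarrow> real) set" where
  "op_range p K = {f \<in> Lp_space p lebesgue.
     (\<exists>g\<in>Lp_space p lebesgue. AE x in lebesgue. f x = int_op K g x) \<and>
     (\<forall>x. f x = int_op K f x)}"

definition concentrated ::
  "real \<Rightarrow> (real ^ 'n \<Rightarrow> real ^ 'n \<Rightarrow> real) \<Rightarrow> real \<Rightarrow> real \<Rightarrow> (real ^ 'n \<Rightarrow> real) set" where
  "concentrated p K R \<delta> = {f \<in> op_range p K.
     1 - \<delta> \<le> (LINT x:cube (R / 2)|lebesgue. \<bar>f x\<bar> powr p) \<and> Lp_norm p lebesgue f = 1}"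

text \<open>
  \<open>Metric_space.mtotally_bounded\<close> does not apply directly, since \<open>d\<close> is only a pseudometric
  here: functions may agree on the cube and differ outside of it.
\<close>

definition totally_bounded_wrt :: "('a \<Rightarrow> 'a \<Rightarrow> ereal) \<Rightarrow> 'a set \<Rightarrow> bool" where
  "totally_bounded_wrt d S \<longleftrightarrow>
     (\<forall>e::real. 0 < e \<longrightarrow> (\<exists>F. finite F \<and> F \<subseteq> S \<and> (\<forall>f\<in>S. \<exists>g\<in>F. d f g < ereal e)))"

end

theory Submission
  imports Defs
begin

text \<open>
  By the decay of the kernel and \<open>\<bar>t\<bar> \<le> 1 + \<bar>t\<bar> powr p\<close>, every \<open>f\<close> in the set is
  bounded by one constant \<open>M\<close>. Feeding this bound back into \<open>f x = \<integral> K x y * f y dy\<close> gives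
  \<open>\<bar>f (x + h) - f x\<bar> \<le> M * \<integral> osc_envelope \<epsilon> K\<close> for \<open>h\<close> in the cube of half-width \<open>\<epsilon>\<close>, so the
  set is uniformly equicontinuous, and the Arzela-Ascoli argument applies on the compact cube.
  The difference of the two integrals may be taken under the integral sign because
  regularity makes every section \<open>K x\<close> continuous almost everywhere, hence measurable.
\<close>

section \<open>Arzela-Ascoli: finite uniform nets on a compact set\<close>

text \<open>Record each function by its values on a finite \<open>d\<close>-net of \<open>Q\<close>,
  rounded down to multiples of \<open>\<eta>\<close>. Boundedness leaves finitely many records, and
  equicontinuity carries closeness from the net to all of \<open>Q\<close>.\<close>

lemma finite_uniform_net:
  fixes S :: "('a::metric_space \<Rightarrow> real) set"
  assumes Q: "compact Q"
    and bounded: "\<And>f x. f \<in> S \<Longrightarrow> x \<in> Q \<Longrightarrow> \<bar>f x\<bar> \<le> M"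
    and equicont: "\<And>e. e > 0 \<Longrightarrow> \<exists>d>0. \<forall>f\<in>S. \<forall>x\<in>Q. \<forall>y\<in>Q. dist x y < d \<longrightarrow> \<bar>f x - f y\<bar> < e"
    and e: "e > 0"
  shows "\<exists>F. finite F \<and> F \<subseteq> S \<and> (\<forall>f\<in>S. \<exists>g\<in>F. \<forall>x\<in>Q. \<bar>f x - g x\<bar> < e)"
proof -
  \<comment> \<open>One third each for the two moves between \<open>x\<close> and a net point
    \<open>q\<close>, and one for the rounding at \<open>q\<close>.\<close>
  define \<eta> where "\<eta> = e / 3"
  have \<eta>: "\<eta> > 0" "e = 3 * \<eta>" using e by (auto simp: \<eta>_def)
  obtain d where d: "d > 0" "\<And>f x y. f \<in> S \<Longrightarrow> x \<in> Q \<Longrightarrow> y \<in> Q \<Longrightarrow> dist x y < d \<Longrightarrow> \<bar>f x - f y\<bar> < \<eta>"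
    using equicont[OF \<eta>(1)] by blast
  obtain P where P: "finite P" "P \<subseteq> Q" "Q \<subseteq> (\<Union>x\<in>P. ball x d)"
    using compactE_image[OF Q, of Q "\<lambda>x. ball x d"] d(1) by (metis UN_I centre_in_ball open_ball subsetI)
  \<comment> \<open>\<open>restrict\<close> makes records equal as functions exactly when they agree
    on \<open>P\<close>, and so places them in a finite \<open>PiE\<close>.\<close>
  define \<Phi> where "\<Phi> f = restrict (\<lambda>q. \<lfloor>f q / \<eta>\<rfloor>) P" for f
  have "\<Phi> ` S \<subseteq> PiE P (\<lambda>_. {\<lfloor>- M / \<eta>\<rfloor>..\<lfloor>M / \<eta>\<rfloor>})"
  proof (clarify, rule PiE_I)
    fix f q assume "f \<in> S" "q \<in> P"
    then have "- M \<le> f q" "f q \<le> M" using bounded[of f q] P(2) by (auto simp: abs_le_iff)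
    then have "- M / \<eta> \<le> f q / \<eta>" "f q / \<eta> \<le> M / \<eta>"
      using \<eta>(1) by (auto intro!: divide_right_mono simp del: divide_minus_left)
    then show "\<Phi> f q \<in> {\<lfloor>- M / \<eta>\<rfloor>..\<lfloor>M / \<eta>\<rfloor>}"
      unfolding \<Phi>_def using \<open>q \<in> P\<close> by (auto intro!: floor_mono simp del: divide_minus_left)
  qed (auto simp: \<Phi>_def)
  then have fin: "finite (\<Phi> ` S)"
    by (rule finite_subset) (auto intro!: finite_PiE P(1))
  \<comment> \<open>One member of \<open>S\<close> is kept for each record that occurs, so the net
    consists of elements of \<open>S\<close>.\<close>
  obtain F where F: "F \<subseteq> S" "finite F" "\<Phi> ` S = \<Phi> ` F"
    using finite_subset_image[OF fin subset_refl] by metis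
  have "\<exists>g\<in>F. \<forall>x\<in>Q. \<bar>f x - g x\<bar> < e" if f: "f \<in> S" for f
  proof -
    obtain g where g: "g \<in> F" "\<Phi> f = \<Phi> g" using F(3) f by (metis image_iff)
    have gS: "g \<in> S" using F(1) g(1) by blast
    have "\<bar>f x - g x\<bar> < e" if x: "x \<in> Q" for x
    proof -
      obtain q where q: "q \<in> P" "dist q x < d" using P(3) x by auto
      have qQ: "q \<in> Q" using P(2) q(1) by blast
      have "\<lfloor>f q / \<eta>\<rfloor> = \<lfloor>g q / \<eta>\<rfloor>"
        using fun_cong[OF g(2), of q] q(1) by (simp add: \<Phi>_def)
      then have "\<bar>f q / \<eta> - g q / \<eta>\<bar> < 1" by linarith
      then have "\<bar>f q - g q\<bar> < \<eta>"
        using \<eta>(1) by (simp flip: diff_divide_distrib)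
      moreover have "\<bar>f q - f x\<bar> < \<eta>" "\<bar>g q - g x\<bar> < \<eta>"
        using d(2)[OF f qQ x q(2)] d(2)[OF gS qQ x q(2)] .
      ultimately show ?thesis using \<eta>(2) by linarith
    qed
    then show ?thesis using g(1) by blast
  qed
  then show ?thesis using F by blast
qed

section \<open>Reflections of Lebesgue measure; measurability from continuity\<close>

text \<open>The reflection is the affine map whose scaling factors are all -1, so its Jacobian
  factor is 1. It turns integrals of functions of \<open>x - y\<close> into integrals that are free
  of \<open>x\<close>.\<close>

lemma
  fixes a :: "'a::euclidean_space"
  shows distr_lebesgue_reflect: "distr lebesgue lebesgue (\<lambda>y. a - y) = lebesgue"
    and measurable_lebesgue_reflect: "(\<lambda>y. a - y) \<in> lebesgue \<rightarrow>\<^sub>M lebesgue"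
proof -
  have eq: "a + (\<Sum>j\<in>Basis. (- 1 * (x \<bullet> j)) *\<^sub>R j) = a - x" for x :: 'a
    by (simp add: sum_negf euclidean_representation)
  show "(\<lambda>y. a - y) \<in> lebesgue \<rightarrow>\<^sub>M lebesgue"
    using lebesgue_affine_measurable[of "\<lambda>_. -1" a] unfolding eq by simp
  show "distr lebesgue lebesgue (\<lambda>y. a - y) = lebesgue"
    using lebesgue_affine_euclidean[of "\<lambda>_. -1" a] unfolding eq by (simp add: density_1)
qed

lemma nn_integral_lebesgue_reflect:
  fixes g :: "'a::euclidean_space \<Rightarrow> ennreal"
  assumes "g \<in> borel_measurable lebesgue"
  shows "(\<integral>\<^sup>+ y. g (a - y) \<partial>lebesgue) = (\<integral>\<^sup>+ y. g y \<partial>lebesgue)"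
  using nn_integral_distr[OF measurable_lebesgue_reflect, of g a] assms
  by (simp add: distr_lebesgue_reflect)

lemma AE_lebesgue_reflect:
  fixes a :: "'a::euclidean_space"
  assumes "AE y in lebesgue. P y"
  shows "AE y in lebesgue. P (a - y)"
  by (rule AE_distrD[OF measurable_lebesgue_reflect]) (simp only: distr_lebesgue_reflect assms)

text \<open>The continuity points have a null complement, hence form a Lebesgue set. On it
  \<open>f\<close> is continuous, and values on a null set do not affect Lebesgue
  measurability.\<close>

lemma borel_measurable_lebesgue_AE_isCont:
  fixes f :: "'a::euclidean_space \<Rightarrow> real"
  assumes "AE x in lebesgue. isCont f x"
  shows "f \<in> borel_measurable lebesgue"
proof -
  define S where "S = {x. isCont f x}"
  have "- S \<in> null_sets lebesgue"
    using assms unfolding completion.AE_iff_null_sets by (simp add: S_def Compl_eq)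
  then have S: "S \<in> sets lebesgue"
    by (metis Compl_eq_Diff_UNIV double_complement null_setsD2 sets.compl_sets space_completion space_lborel space_borel)
  have "f \<in> borel_measurable (lebesgue_on S)"
    by (rule continuous_imp_measurable_on_sets_lebesgue[OF _ S])
      (auto simp: S_def intro!: continuous_at_imp_continuous_on)
  from borel_measurable_if_I[OF this S] show ?thesis
    by (rule borel_measurable_AE) (use assms in \<open>auto simp: S_def\<close>)
qed

section \<open>Integrability of the decay weight\<close>

lemma norm1_nonneg: "0 \<le> norm1 x"
  by (simp add: norm1_def sum_nonneg)

lemma mem_cube: "(x :: real ^ 'n) \<in> cube r \<longleftrightarrow> (\<forall>i. \<bar>x $ i\<bar> \<le> r)"
  by (auto simp: cube_def mem_box_cart abs_le_iff minus_le_iff)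

lemma cube_norm1: "x \<in> cube (norm1 x)"
  unfolding mem_cube norm1_def by (auto intro: member_le_sum)

lemma emeasure_cube:
  assumes "0 \<le> r"
  shows "emeasure lebesgue (cube r :: (real ^ 'n) set) = ennreal ((2 * r) ^ CARD('n))"
proof -
  have ne: "cbox (\<chi> i. - r) (\<chi> i. r) \<noteq> ({} :: (real ^ 'n) set)"
    using assms by (simp add: interval_ne_empty_cart)
  have "measure lborel (cube r :: (real ^ 'n) set) = (2 * r) ^ CARD('n)"
    unfolding cube_def content_cbox_cart[OF ne] by simp
  moreover have "emeasure lborel (cube r :: (real ^ 'n) set) = ennreal (measure lborel (cube r :: (real ^ 'n) set))"
    unfolding cube_def
    by (intro emeasure_eq_ennreal_measure less_imp_neq[OF emeasure_lborel_cbox_finite[unfolded infinity_ennreal_def]])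
  ultimately show ?thesis
    by (simp add: cube_def)
qed

lemma borel_measurable_norm1_powr:
  "(\<lambda>y :: real ^ 'n. 1 / (1 + norm1 y) powr \<alpha>) \<in> borel_measurable lebesgue"
  unfolding norm1_def by (intro measurable_completion) simp

text \<open>Points with \<open>norm1 y\<close> between \<open>k\<close> and \<open>k + 1\<close> lie
  in the cube of half-width \<open>1 + k\<close>, and the weight there is at most
  \<open>c k\<close>. Volume times weight is a constant times \<open>1 + k\<close> to the power n -
  \<alpha>. Whole cubes instead of shells cost one power of \<open>1 + k\<close>, which n + 1 <
  \<alpha> permits.\<close>

lemma integrable_norm1_powr:
  assumes \<alpha>: "real CARD('n) + 1 < \<alpha>"
  shows "integrable lebesgue (\<lambda>y :: real ^ 'n. 1 / (1 + norm1 y) powr \<alpha>)"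
proof (rule integrableI_nonneg)
  define c where "c k = 1 / (1 + real k) powr \<alpha>" for k
  define s where "s = real CARD('n) - \<alpha>"
  have single: "a k \<le> (\<Sum>k. a k)" for a :: "nat \<Rightarrow> ennreal" and k
    using sum_le_suminf[OF summableI, of "{k}" a] by simp
  have pw: "ennreal (1 / (1 + norm1 y) powr \<alpha>) \<le> (\<Sum>k. ennreal (c k) * indicator (cube (1 + real k)) y)"
    for y :: "real ^ 'n"
  proof -
    define k where "k = nat \<lfloor>norm1 y\<rfloor>"
    have k: "real k \<le> norm1 y" "norm1 y \<le> 1 + real k"
      unfolding k_def using norm1_nonneg[of y] by linarith+
    have "1 / (1 + norm1 y) powr \<alpha> \<le> c k"
      unfolding c_def using k \<alpha> by (intro divide_left_mono powr_mono2 mult_pos_pos) auto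
    moreover have "y \<in> cube (1 + real k)"
      using cube_norm1[of y] k(2) unfolding mem_cube by (meson order_trans)
    ultimately have "ennreal (1 / (1 + norm1 y) powr \<alpha>) \<le> ennreal (c k) * indicator (cube (1 + real k)) y"
      by (simp add: ennreal_leI)
    also have "\<dots> \<le> (\<Sum>k. ennreal (c k) * indicator (cube (1 + real k)) y)"
      by (rule single[of "\<lambda>k. ennreal (c k) * indicator (cube (1 + real k)) y"])
    finally show ?thesis .
  qed
  have "(\<integral>\<^sup>+ y. ennreal (1 / (1 + norm1 (y :: real ^ 'n)) powr \<alpha>) \<partial>lebesgue)
      \<le> (\<integral>\<^sup>+ y. (\<Sum>k. ennreal (c k) * indicator (cube (1 + real k)) (y :: real ^ 'n)) \<partial>lebesgue)"
    by (intro nn_integral_mono pw)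
  also have "\<dots> = (\<Sum>k. \<integral>\<^sup>+ y. ennreal (c k) * indicator (cube (1 + real k)) (y :: real ^ 'n) \<partial>lebesgue)"
    by (intro nn_integral_suminf borel_measurable_times_ennreal borel_measurable_const borel_measurable_indicator)
      (simp add: cube_def)
  also have "\<dots> = (\<Sum>k. ennreal (c k) * emeasure lebesgue (cube (1 + real k) :: (real ^ 'n) set))"
    by (intro suminf_cong nn_integral_cmult_indicator) (simp add: cube_def)
  also have "\<dots> = (\<Sum>k. ennreal (2 ^ CARD('n) * real (Suc k) powr s))"
  proof (intro suminf_cong)
    fix k
    have "c k * (2 * (1 + real k)) ^ CARD('n) = 2 ^ CARD('n) * real (Suc k) powr s"
      unfolding c_def s_def power_mult_distrib by (simp add: powr_diff powr_realpow)
    then show "ennreal (c k) * emeasure lebesgue (cube (1 + real k) :: (real ^ 'n) set)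
        = ennreal (2 ^ CARD('n) * real (Suc k) powr s)"
      by (subst emeasure_cube) (simp_all add: ennreal_mult'[symmetric] c_def)
  qed
  also have "\<dots> < \<infinity>"
  proof -
    \<comment> \<open>The exponent \<open>s\<close> is below -1; the series above starts at base 1,
      hence the shift by one index.\<close>
    have "summable (\<lambda>k. real k powr s)"
      using \<alpha> by (simp add: summable_real_powr_iff s_def)
    then have "summable (\<lambda>k. 2 ^ CARD('n) * real (Suc k) powr s)"
      by (intro summable_mult) (subst summable_Suc_iff)
    then show ?thesis
      by (subst suminf_ennreal2) auto
  qed
  finally show "(\<integral>\<^sup>+ y. ennreal (1 / (1 + norm1 (y :: real ^ 'n)) powr \<alpha>) \<partial>lebesgue) < \<infinity>" .
qed (auto intro: borel_measurable_norm1_powr)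

section \<open>The oscillation envelope and the sections of the kernel\<close>

lemma osc_le_envelope:
  fixes K :: "real ^ 'n \<Rightarrow> real ^ 'n \<Rightarrow> real"
  assumes "a \<in> cube \<epsilon>" "b \<in> cube \<epsilon>"
  shows "ennreal \<bar>K (x + a) (y + b) - K x y\<bar> \<le> osc_envelope \<epsilon> K (x - y)"
proof -
  have "ennreal \<bar>K (x + a) (y + b) - K x y\<bar> \<le> osc \<epsilon> K x y"
    unfolding osc_def using assms by (intro SUP_upper2[of a] SUP_upper2[of b]) auto
  \<comment> \<open>The choice \<open>z = y\<close> turns \<open>(x - y) + z\<close> into
    \<open>x\<close>.\<close>
  also have "\<dots> \<le> osc_envelope \<epsilon> K (x - y)"
    unfolding osc_envelope_def by (intro SUP_upper2[of y]) auto
  finally show ?thesis .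
qed

text \<open>The infimum of the envelopes along a sequence of radii tending to 0 lies below each of
  them, so its integral is 0 and it vanishes almost everywhere.\<close>

lemma regular_kernel_AE_small:
  fixes K :: "real ^ 'n \<Rightarrow> real ^ 'n \<Rightarrow> real"
  assumes "regular_kernel K"
  shows "AE d in lebesgue. \<forall>e>0. \<exists>\<epsilon>>0. osc_envelope \<epsilon> K d < ennreal e"
proof -
  define \<epsilon> where "\<epsilon> k = inverse (real (Suc k))" for k
  have \<epsilon>: "filterlim \<epsilon> (at_right 0) sequentially"
    unfolding \<epsilon>_def filterlim_at using LIMSEQ_inverse_real_of_nat by simp
  have lim: "(\<lambda>k. \<integral>\<^sup>+ x. osc_envelope (\<epsilon> k) K x \<partial>lebesgue) \<longlonglongrightarrow> 0"
    using assms filterlim_compose[OF _ \<epsilon>] unfolding regular_kernel_def by blast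
  have "\<forall>\<^sub>F k in sequentially. osc_envelope (\<epsilon> k) K \<in> borel_measurable lebesgue"
    using assms \<epsilon> unfolding regular_kernel_def filterlim_iff by blast
  then obtain k0 where k0: "\<And>k. k \<ge> k0 \<Longrightarrow> osc_envelope (\<epsilon> k) K \<in> borel_measurable lebesgue"
    unfolding eventually_sequentially by blast
  \<comment> \<open>The envelope is measurable only for small radii, so the infimum starts at
    \<open>k0\<close>.\<close>
  define g where "g d = (INF k. osc_envelope (\<epsilon> (k + k0)) K d)" for d
  have g_meas: "g \<in> borel_measurable lebesgue"
    unfolding g_def by (intro borel_measurable_INF) (auto intro: k0)
  have "(\<integral>\<^sup>+ d. g d \<partial>lebesgue) \<le> 0"
  proof (rule LIMSEQ_le_const[OF LIMSEQ_ignore_initial_segment[OF lim, of k0]], intro exI allI impI)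
    fix k
    show "(\<integral>\<^sup>+ d. g d \<partial>lebesgue) \<le> (\<integral>\<^sup>+ x. osc_envelope (\<epsilon> (k + k0)) K x \<partial>lebesgue)"
      unfolding g_def by (intro nn_integral_mono INF_lower) auto
  qed
  then have "AE d in lebesgue. g d = 0"
    using nn_integral_0_iff_AE[OF g_meas] by simp
  then show ?thesis
  proof eventually_elim
    case (elim d)
    show ?case
    proof (intro allI impI)
      fix e :: real assume "e > 0"
      then have "g d < ennreal e" using elim by simp
      then obtain k where "osc_envelope (\<epsilon> (k + k0)) K d < ennreal e"
        unfolding g_def by (auto simp: INF_less_iff)
      moreover have "\<epsilon> (k + k0) > 0" by (simp add: \<epsilon>_def)
      ultimately show "\<exists>\<epsilon>>0. osc_envelope \<epsilon> K d < ennreal e" by blast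
    qed
  qed
qed

text \<open>Where the envelope at \<open>x - y\<close> becomes arbitrarily small, \<open>K x\<close>
  is continuous at \<open>y\<close>. The integral formula is used at every point, so every section
  has to be measurable.\<close>

lemma regular_kernel_section_measurable:
  fixes K :: "real ^ 'n \<Rightarrow> real ^ 'n \<Rightarrow> real"
  assumes "regular_kernel K"
  shows "K x \<in> borel_measurable lebesgue"
proof (rule borel_measurable_lebesgue_AE_isCont)
  show "AE y in lebesgue. isCont (K x) y"
    \<comment> \<open>The exceptional null set consists of differences \<open>x - y\<close>;
      reflecting it gives a null set of \<open>y\<close>.\<close>
    using AE_lebesgue_reflect[OF regular_kernel_AE_small[OF assms], of x]
  proof eventually_elim
    case (elim y)
    show ?case
      unfolding continuous_at_eps_delta
    proof (intro allI impI)
      fix e :: real assume "e > 0"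
      then obtain \<epsilon> where \<epsilon>: "\<epsilon> > 0" "osc_envelope \<epsilon> K (x - y) < ennreal e"
        using elim by blast
      have "dist (K x y') (K x y) < e" if "dist y' y < \<epsilon>" for y'
      proof -
        have "y' - y \<in> cube \<epsilon>" "0 \<in> cube \<epsilon>"
          unfolding mem_cube using that \<epsilon>(1)
          by (auto simp: dist_norm intro: order_trans[OF component_le_norm_cart] less_imp_le
              simp del: vector_minus_component)
        from osc_le_envelope[OF this(2,1), of K x y] \<epsilon>(2)
        have "ennreal \<bar>K x y' - K x y\<bar> < ennreal e"
          by simp
        then show ?thesis
          by (simp add: dist_real_def ennreal_less_iff)
      qed
      then show "\<exists>d>0. \<forall>x'. dist x' y < d \<longrightarrow> dist (K x x') (K x y) < e"
        using \<epsilon>(1) by blast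
    qed
  qed
qed

section \<open>Pointwise bounds and increments of the integral operator\<close>

text \<open>In place of Hoelder's inequality, the product is dominated by
  \<open>C * (w (x - y) + \<bar>f y\<bar> powr p)\<close>. By reflection the integral of this
  majorant does not depend on \<open>x\<close>.\<close>

lemma
  fixes K :: "real ^ 'n \<Rightarrow> real ^ 'n \<Rightarrow> real"
  assumes p: "1 \<le> p" and regularity: "regular_kernel K" and "0 < C"
    and \<alpha>: "real CARD('n) + 1 < \<alpha>"
    and decay: "\<And>x y. \<bar>K x y\<bar> \<le> C / (1 + norm1 (x - y)) powr \<alpha>"
    and f: "f \<in> Lp_space p lebesgue"
  shows integrable_kernel_mult: "integrable lebesgue (\<lambda>y. K x y * f y)"
    and int_op_bound: "\<bar>int_op K f x\<bar> \<le> C * ((\<integral>y. 1 / (1 + norm1 (y :: real ^ 'n)) powr \<alpha> \<partial>lebesgue)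
          + (\<integral>y. \<bar>f y\<bar> powr p \<partial>lebesgue))"
proof -
  define w where "w y = 1 / (1 + norm1 y) powr \<alpha>" for y :: "real ^ 'n"
  have w: "integrable lebesgue w"
    unfolding w_def by (rule integrable_norm1_powr[OF \<alpha>])
  have w_reflect: "integrable lebesgue (\<lambda>y. w (x - y))"
    using integrable_distr[OF measurable_lebesgue_reflect, of x w] w
    by (simp add: distr_lebesgue_reflect)
  have int_w: "(\<integral>y. w (x - y) \<partial>lebesgue) = (\<integral>y. w y \<partial>lebesgue)"
    using integral_distr[OF measurable_lebesgue_reflect, of w x] w
    by (simp add: distr_lebesgue_reflect)
  have f_meas: "f \<in> borel_measurable lebesgue" and f_int: "integrable lebesgue (\<lambda>y. \<bar>f y\<bar> powr p)"
    using f by (auto simp: Lp_space_def)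
  have dom: "integrable lebesgue (\<lambda>y. C * (w (x - y) + \<bar>f y\<bar> powr p))"
    using w_reflect f_int by simp
  have bound: "\<bar>K x y * f y\<bar> \<le> C * (w (x - y) + \<bar>f y\<bar> powr p)" for y
  proof -
    \<comment> \<open>\<open>w \<le> 1\<close> allows the mixed term
      \<open>w (x - y) * \<bar>f y\<bar> powr p\<close> to be replaced by
      \<open>\<bar>f y\<bar> powr p\<close>.\<close>
    have w01: "0 \<le> w (x - y)" "w (x - y) \<le> 1"
      unfolding w_def using norm1_nonneg[of "x - y"] \<alpha> by (auto simp: ge_one_powr_ge_zero)
    have t: "\<bar>f y\<bar> \<le> 1 + \<bar>f y\<bar> powr p"
    proof (cases "\<bar>f y\<bar> \<le> 1")
      case False
      then show ?thesis using powr_mono[of 1 p "\<bar>f y\<bar>"] p by simp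
    qed (simp add: add_increasing2)
    have "\<bar>K x y * f y\<bar> \<le> (C * w (x - y)) * (1 + \<bar>f y\<bar> powr p)"
      unfolding abs_mult using decay[of x y] t \<open>0 < C\<close> w01(1)
      by (intro mult_mono) (auto simp: w_def)
    also have "\<dots> = C * (w (x - y) + w (x - y) * \<bar>f y\<bar> powr p)"
      by (simp add: algebra_simps)
    also have "\<dots> \<le> C * (w (x - y) + \<bar>f y\<bar> powr p)"
      using \<open>0 < C\<close> w01 by (intro mult_left_mono add_left_mono mult_left_le_one_le) auto
    finally show ?thesis .
  qed
  show int: "integrable lebesgue (\<lambda>y. K x y * f y)"
  proof (rule Bochner_Integration.integrable_bound[OF dom])
    show "(\<lambda>y. K x y * f y) \<in> borel_measurable lebesgue"
      using f_meas regular_kernel_section_measurable[OF regularity] by (rule borel_measurable_times[rotated])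
    show "AE y in lebesgue. norm (K x y * f y) \<le> norm (C * (w (x - y) + \<bar>f y\<bar> powr p))"
      using bound by (auto intro!: AE_I2 intro: order_trans[OF _ abs_ge_self])
  qed
  have "\<bar>int_op K f x\<bar> \<le> (\<integral>y. \<bar>K x y * f y\<bar> \<partial>lebesgue)"
    unfolding int_op_def by (rule integral_abs_bound)
  also have "\<dots> \<le> (\<integral>y. C * (w (x - y) + \<bar>f y\<bar> powr p) \<partial>lebesgue)"
    by (intro integral_mono dom integrable_abs int bound)
  also have "\<dots> = C * ((\<integral>y. w y \<partial>lebesgue) + (\<integral>y. \<bar>f y\<bar> powr p \<partial>lebesgue))"
    using w_reflect f_int by (simp add: int_w)
  finally show "\<bar>int_op K f x\<bar> \<le> C * ((\<integral>y. 1 / (1 + norm1 (y :: real ^ 'n)) powr \<alpha> \<partial>lebesgue)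
          + (\<integral>y. \<bar>f y\<bar> powr p \<partial>lebesgue))"
    unfolding w_def .
qed

text \<open>Only the first kernel argument moves, so the integrand changes by at most
  \<open>M\<close> times the envelope at \<open>x - y\<close>. Reflection then removes
  \<open>x\<close>, making the bound uniform in \<open>x\<close> and in all \<open>f\<close> sharing
  the bound \<open>M\<close>.\<close>

lemma int_op_increment:
  fixes K :: "real ^ 'n \<Rightarrow> real ^ 'n \<Rightarrow> real"
  assumes int: "\<And>x. integrable lebesgue (\<lambda>y. K x y * f y)"
    and bound: "\<And>y. \<bar>f y\<bar> \<le> M"
    and h: "h \<in> cube \<epsilon>"
    and meas: "osc_envelope \<epsilon> K \<in> borel_measurable lebesgue"
  shows "ennreal \<bar>int_op K f (x + h) - int_op K f x\<bar>
    \<le> ennreal M * (\<integral>\<^sup>+ d. osc_envelope \<epsilon> K d \<partial>lebesgue)"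
proof -
  \<comment> \<open>The zero increment is for the second argument; \<open>h\<close> in the cube
    forces \<epsilon> to be nonnegative.\<close>
  have "0 \<in> cube \<epsilon>"
    using h unfolding mem_cube by (metis abs_ge_zero abs_zero order_trans zero_index)
  note osc = osc_le_envelope[OF h this, of K x, simplified]
  have "int_op K f (x + h) - int_op K f x = (\<integral>y. K (x + h) y * f y - K x y * f y \<partial>lebesgue)"
    unfolding int_op_def by (rule Bochner_Integration.integral_diff[symmetric]) (rule int)+
  then have "ennreal \<bar>int_op K f (x + h) - int_op K f x\<bar>
      \<le> (\<integral>\<^sup>+ y. ennreal \<bar>K (x + h) y * f y - K x y * f y\<bar> \<partial>lebesgue)"
    using integral_norm_bound_ennreal[OF Bochner_Integration.integrable_diff[OF int[of "x + h"] int[of x]]]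
    by simp
  also have "\<dots> \<le> (\<integral>\<^sup>+ y. ennreal M * osc_envelope \<epsilon> K (x - y) \<partial>lebesgue)"
  proof (intro nn_integral_mono)
    fix y
    have "ennreal \<bar>K (x + h) y * f y - K x y * f y\<bar> = ennreal \<bar>f y\<bar> * ennreal \<bar>K (x + h) y - K x y\<bar>"
      by (simp add: ennreal_mult[symmetric] abs_mult[symmetric] algebra_simps)
    also have "\<dots> \<le> ennreal M * osc_envelope \<epsilon> K (x - y)"
      using bound[of y] osc[of y] by (intro mult_mono ennreal_leI) auto
    finally show "ennreal \<bar>K (x + h) y * f y - K x y * f y\<bar> \<le> ennreal M * osc_envelope \<epsilon> K (x - y)" .
  qed
  also have "\<dots> = ennreal M * (\<integral>\<^sup>+ y. osc_envelope \<epsilon> K (x - y) \<partial>lebesgue)"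
    by (intro nn_integral_cmult measurable_compose[OF measurable_lebesgue_reflect meas])
  also have "\<dots> = ennreal M * (\<integral>\<^sup>+ d. osc_envelope \<epsilon> K d \<partial>lebesgue)"
    by (simp add: nn_integral_lebesgue_reflect[OF meas])
  finally show ?thesis .
qed

section \<open>From uniform nets to total boundedness in the essential supremum norm\<close>

lemma Linf_norm_le:
  assumes "f \<in> borel_measurable M" "\<And>x. x \<in> space M \<Longrightarrow> \<bar>f x\<bar> \<le> c"
  shows "Linf_norm M f \<le> ereal c"
proof -
  have meas: "(\<lambda>x. ereal \<bar>f x\<bar>) \<in> borel_measurable M" using assms(1) by simp
  show ?thesis
    unfolding Linf_norm_def esssup_eq_AE[OF meas]
    using assms(2) by (intro Inf_lower) auto
qed

theorem lemma2p4:
  fixes K :: "real ^ 'n \<Rightarrow> real ^ 'n \<Rightarrow> real"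
    and p C \<alpha> R \<delta> :: real
  assumes p: "1 \<le> p"
    and K_measurable: "(\<lambda>(x, y). K x y) \<in> borel_measurable lebesgue"
    and maps_to: "\<And>f. f \<in> Lp_space p lebesgue \<Longrightarrow> int_op K f \<in> Lp_space p lebesgue"
    and idempotent: "\<And>f. f \<in> Lp_space p lebesgue \<Longrightarrow>
          AE x in lebesgue. int_op K (int_op K f) x = int_op K f x"
    and symmetric: "\<And>x y. K x y = K y x"
    and regularity: "regular_kernel K"
    and C: "0 < C"
    and \<alpha>: "real CARD('n) * inverse_conjugate p + real CARD('n) + 1 < \<alpha>"
    and decay: "\<And>x y. \<bar>K x y\<bar> \<le> C / (1 + norm1 (x - y)) powr \<alpha>"
    and R: "0 < R"
    and \<delta>: "\<delta> < 1"
  shows "totally_bounded_wrt (\<lambda>f g. Linf_norm (lebesgue_on (cube (R / 2))) (\<lambda>x. f x - g x))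
           (concentrated p K R \<delta>)"
proof -
  define S where "S = concentrated p K R \<delta>"
  \<comment> \<open>The value of \<open>int_op_bound\<close> when the integral of
    \<open>\<bar>f y\<bar> powr p\<close> is 1.\<close>
  define M where "M = C * ((\<integral>y. 1 / (1 + norm1 (y :: real ^ 'n)) powr \<alpha> \<partial>lebesgue) + 1)"
  have "0 \<le> inverse_conjugate p"
    using p by (simp add: inverse_conjugate_def)
  then have "0 \<le> real CARD('n) * inverse_conjugate p"
    by simp
  then have \<alpha>': "real CARD('n) + 1 < \<alpha>"
    using \<alpha> by linarith
  have S_Lp: "f \<in> Lp_space p lebesgue" and S_fix: "int_op K f x = f x"
    and S_int: "(\<integral>y. \<bar>f y\<bar> powr p \<partial>lebesgue) = 1" if "f \<in> S" for f x
  proof -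
    show "f \<in> Lp_space p lebesgue" "int_op K f x = f x"
      using that by (auto simp: S_def concentrated_def op_range_def)
    \<comment> \<open>The normalisation fixes only \<open>A powr (1 / p)\<close>; raising it to the
      power \<open>p\<close> recovers \<open>A\<close>, since \<open>A\<close> is
      nonnegative.\<close>
    define A where "A = (\<integral>y. \<bar>f y\<bar> powr p \<partial>lebesgue)"
    have "0 \<le> A" unfolding A_def by simp
    moreover have "A powr (1 / p) = 1"
      using that by (simp add: S_def concentrated_def Lp_norm_def A_def)
    then have "(A powr (1 / p)) powr p = 1" by simp
    ultimately show "A = 1" using p by (simp add: powr_powr)
  qed
  have bound: "\<bar>f x\<bar> \<le> M" if "f \<in> S" for f x
    using int_op_bound[OF p regularity C \<alpha>' decay S_Lp[OF that], of x]
    by (simp add: S_fix[OF that] S_int[OF that] M_def)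
  have equicont: "\<exists>d>0. \<forall>f\<in>S. \<forall>x\<in>cube (R / 2). \<forall>y\<in>cube (R / 2). dist x y < d \<longrightarrow> \<bar>f x - f y\<bar> < e"
    if "e > 0" for e
  proof -
    \<comment> \<open>The increment bound tends to 0 with \<epsilon>, so one small radius serves all
      of \<open>S\<close>; it becomes the modulus \<open>d\<close>.\<close>
    have "((\<lambda>\<epsilon>. ennreal M * (\<integral>\<^sup>+ d. osc_envelope \<epsilon> K d \<partial>lebesgue)) \<longlongrightarrow> ennreal M * 0) (at_right 0)"
      using regularity unfolding regular_kernel_def by (intro ennreal_tendsto_cmult) auto
    then have "\<forall>\<^sub>F \<epsilon> in at_right 0. ennreal M * (\<integral>\<^sup>+ d. osc_envelope \<epsilon> K d \<partial>lebesgue) < ennreal e"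
      using that by (intro order_tendstoD(2)) auto
    moreover have "\<forall>\<^sub>F \<epsilon> in at_right 0. osc_envelope \<epsilon> K \<in> borel_measurable lebesgue"
      using regularity unfolding regular_kernel_def by blast
    moreover have "\<forall>\<^sub>F \<epsilon> :: real in at_right 0. \<epsilon> > 0"
      by (rule eventually_at_right_less)
    ultimately have "\<forall>\<^sub>F \<epsilon> in at_right 0. ennreal M * (\<integral>\<^sup>+ d. osc_envelope \<epsilon> K d \<partial>lebesgue) < ennreal e
        \<and> osc_envelope \<epsilon> K \<in> borel_measurable lebesgue \<and> \<epsilon> > 0"
      by eventually_elim blast
    then obtain \<epsilon> where \<epsilon>: "ennreal M * (\<integral>\<^sup>+ d. osc_envelope \<epsilon> K d \<partial>lebesgue) < ennreal e"
        "osc_envelope \<epsilon> K \<in> borel_measurable lebesgue" "\<epsilon> > 0"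
      using eventually_happens[of _ "at_right (0::real)"] trivial_limit_at_right_real by blast
    have "\<bar>f x - f y\<bar> < e" if f: "f \<in> S" and "dist x y < \<epsilon>" for f x y
    proof -
      \<comment> \<open>Coordinates are bounded by the Euclidean norm, so \<open>x\<close> is
        \<open>y + h\<close> with an admissible \<open>h = x - y\<close>.\<close>
      have "x - y \<in> cube \<epsilon>"
        unfolding mem_cube using that(2) component_le_norm_cart[of "x - y"]
        by (metis dist_norm less_imp_le order_trans)
      from int_op_increment[OF integrable_kernel_mult[OF p regularity C \<alpha>' decay S_Lp[OF f]] bound[OF f] this \<epsilon>(2), of y]
      have "ennreal \<bar>f x - f y\<bar> < ennreal e"
        using \<epsilon>(1) by (simp add: S_fix[OF f])
      then show ?thesis by (simp add: ennreal_less_iff)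
    qed
    then show ?thesis using \<epsilon>(3) by blast
  qed
  show ?thesis
    unfolding totally_bounded_wrt_def S_def[symmetric]
  proof (intro allI impI)
    fix e :: real assume "0 < e"
    have "compact (cube (R / 2) :: (real ^ 'n) set)"
      by (simp add: cube_def)
    \<comment> \<open>The net is built for \<open>e / 2\<close> because a strict pointwise bound
      passes to the essential supremum only as \<le>.\<close>
    then have "\<exists>F. finite F \<and> F \<subseteq> S \<and> (\<forall>f\<in>S. \<exists>g\<in>F. \<forall>x\<in>cube (R / 2). \<bar>f x - g x\<bar> < e / 2)"
      by (rule finite_uniform_net[where M = M]) (use bound equicont \<open>0 < e\<close> in auto)
    then obtain F where F: "finite F" "F \<subseteq> S"
      "\<And>f. f \<in> S \<Longrightarrow> \<exists>g\<in>F. \<forall>x\<in>cube (R / 2). \<bar>f x - g x\<bar> < e / 2"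
      by blast
    have "\<exists>g\<in>F. Linf_norm (lebesgue_on (cube (R / 2))) (\<lambda>x. f x - g x) < ereal e" if f: "f \<in> S" for f
    proof -
      obtain g where g: "g \<in> F" "\<And>x. x \<in> cube (R / 2) \<Longrightarrow> \<bar>f x - g x\<bar> < e / 2"
        using F(3)[OF f] by blast
      have "g \<in> S" using F(2) g(1) by blast
      then have "(\<lambda>x. f x - g x) \<in> borel_measurable lebesgue"
        using S_Lp[OF f] S_Lp[of g] by (auto simp: Lp_space_def)
      then have "(\<lambda>x. f x - g x) \<in> borel_measurable (lebesgue_on (cube (R / 2)))"
        by (rule measurable_restrict_space1)
      then have "Linf_norm (lebesgue_on (cube (R / 2))) (\<lambda>x. f x - g x) \<le> ereal (e / 2)"
        using g(2) by (intro Linf_norm_le) (auto simp: less_imp_le)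
      also have "\<dots> < ereal e" using \<open>0 < e\<close> by simp
      finally show ?thesis using g(1) by blast
    qed
    then show "\<exists>F. finite F \<and> F \<subseteq> S \<and>
        (\<forall>f\<in>S. \<exists>g\<in>F. Linf_norm (lebesgue_on (cube (R / 2))) (\<lambda>x. f x - g x) < ereal e)"
      using F(1,2) by blast
  qed
qed

end
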